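(* Let $M$ be a positive integer and $s\in\mathbb{R}$ be fixed. For $\zeta>0$ let $\gamma\sim\mathrm{Gamma}(M,\zeta)$ and $\mathcal{M}_{g(\gamma)}(s)=\mathbb{E}[(1+\gamma)^{s-1}]$. Define $$\mathcal{M}^{\mathrm{H}}_{g(\gamma)}(s) = \begin{cases} \zeta^{s-1}\,\dfrac{\Gamma(s+M-1)}{\Gamma(M)}, & s > 1-M,\\[2mm] \zeta^{-M}\,\dfrac{\Gamma(1-s-M)}{\Gamma(1-s)}, & s < 1-M,\\[2mm] \zeta^{-M}\,\dfrac{\log\zeta - \psi(M)}{\Gamma(M)}, & s = 1-M.\end{cases}$$ Then in the high SNR regime $\zeta\to\infty$ the Mellin transform of the service process scales as $\mathcal{M}^{\mathrm{H}}_{g(\gamma)}(s)$, i.e. $$\lim_{\zeta\to\infty}\frac{\mathcal{M}_{g(\gamma)}(s)}{\mathcal{M}^{\mathrm{H}}_{g(\gamma)}(s)} = 1.$$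
   Context: $\mathrm{Gamma}(M,\zeta)$ is the gamma distribution with shape parameter $M$ and scale parameter $\zeta$, with density $\frac{x^{M-1}e^{-x/\zeta}}{\Gamma(M)\zeta^M}$ for $x\ge0$; $\gamma$ is the instantaneous SNR and $g(\gamma)=1+\gamma$. $\psi=\Gamma'/\Gamma$ is the digamma function and $\log$ is the natural logarithm. *)

theory Defs
  imports "HOL-Probability.Probability"
begin

text \<open>Shape \<open>M\<close> and \<^emph>\<open>scale\<close> (not rate) \<open>\<zeta>\<close>; meaningful for \<open>0 < M\<close> and \<open>0 < \<zeta>\<close>.
  With an integer shape this is the Erlang density of the library, whose parameters are
  \<open>M - 1\<close> and the rate \<open>1 / \<zeta>\<close>; see \<open>gamma_density_eq_erlang\<close> below.\<close>

definition gamma_density :: "nat \<Rightarrow> real \<Rightarrow> real \<Rightarrow> real" where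
  "gamma_density M \<zeta> x =
     (if x < 0 then 0 else x ^ (M - 1) * exp (- x / \<zeta>) / (Gamma (real M) * \<zeta> ^ M))"

lemma gamma_density_eq_erlang:
  assumes "0 < M" and "0 < \<zeta>"
  shows "gamma_density M \<zeta> = erlang_density (M - 1) (1 / \<zeta>)"
proof
  fix x
  from assms obtain k where k: "M = Suc k"
    by (cases M) auto
  have "Gamma (real M) = fact k"
    using Gamma_fact[of k, where 'a = real] by (simp add: k add.commute)
  then show "gamma_density M \<zeta> x = erlang_density (M - 1) (1 / \<zeta>) x"
    using assms by (simp add: gamma_density_def erlang_density_def k field_simps)
qed

definition service :: "real \<Rightarrow> real" where
  "service \<gamma> = 1 + \<gamma>"

definition mellin_transform :: "'a measure \<Rightarrow> ('a \<Rightarrow> real) \<Rightarrow> real \<Rightarrow> real" where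
  "mellin_transform P X s = (\<integral>\<omega>. X \<omega> powr (s - 1) \<partial>P)"

definition mellin_high_snr :: "nat \<Rightarrow> real \<Rightarrow> real \<Rightarrow> real" where
  "mellin_high_snr M \<zeta> s =
     (if s > 1 - real M then \<zeta> powr (s - 1) * (Gamma (s + real M - 1) / Gamma (real M))
      else if s < 1 - real M then \<zeta> powr (- real M) * (Gamma (1 - s - real M) / Gamma (1 - s))
      else \<zeta> powr (- real M) * ((ln \<zeta> - Digamma (real M)) / Gamma (real M)))"

end

theory Submission
  imports Defs "HOL-Real_Asymp.Real_Asymp"
begin

text \<open>
  Up to the factor \<open>\<Gamma>(M) \<zeta>\<^sup>M\<close>, the transform is
  \<open>K(\<zeta>) = \<integral>\<^sub>0\<^sup>\<infinity> x\<^sup>M\<^sup>-\<^sup>1 (1 + x)\<^sup>s\<^sup>-\<^sup>1 e\<^sup>-\<^sup>x\<^sup>/\<^sup>\<zeta> dx\<close>.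
  If \<open>s < 1 - M\<close>, the integrand without its exponential factor is integrable, and dominated convergence
  gives \<open>K(\<zeta>) \<rightarrow> B(M, 1 - s - M)\<close>.
  If \<open>s > 1 - M\<close>, the substitution \<open>x = \<zeta>u\<close> turns \<open>K(\<zeta>) / \<zeta>\<^sup>s\<^sup>+\<^sup>M\<^sup>-\<^sup>1\<close> into
  \<open>\<integral>\<^sub>0\<^sup>\<infinity> u\<^sup>M\<^sup>-\<^sup>1 (1/\<zeta> + u)\<^sup>s\<^sup>-\<^sup>1 e\<^sup>-\<^sup>u du\<close>,
  which converges to a Gamma integral.
  If \<open>s = 1 - M\<close>, the integrand behaves like \<open>1 / (1 + x)\<close> cut off at \<open>x \<approx> \<zeta>\<close>, so that
  \<open>K(\<zeta>) = ln \<zeta> + O(1)\<close>.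
\<close>

section \<open>Gamma and Beta integrals on the half-line\<close>

text \<open>Substitute \<open>c * t\<close> for \<open>t\<close> in Euler's integral. The
  nonnegative form can serve as the inner integral in Tonelli's theorem, where the rates are
  \<open>1 + x\<close> and \<open>t\<close>.\<close>

lemma nn_integral_Gamma_scaled:
  fixes a c :: real
  assumes "a > 0" "c > 0"
  shows "(\<integral>\<^sup>+t. ennreal (indicator {0<..} t * (t powr (a - 1) * exp (- (c * t)))) \<partial>lborel)
    = ennreal (Gamma a * c powr (- a))"
proof -
  let ?f = "\<lambda>t::real. ennreal (indicator {0<..} t * (t powr (a - 1) * exp (- t)))"
  have pos: "0 < c * t \<longleftrightarrow> 0 < t" for t
    using assms by (simp add: zero_less_mult_iff)
  have eq: "ennreal (c powr (a - 1)) * ennreal (indicator {0<..} t * (t powr (a - 1) * exp (- (c * t)))) = ?f (0 + c * t)" for t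
    using assms by (auto simp: powr_mult pos mult_ac split: split_indicator simp flip: ennreal_mult')
  have "ennreal (Gamma a) = (\<integral>\<^sup>+t. ?f t \<partial>lborel)"
    unfolding Gamma_conv_nn_integral_real[OF assms(1)]
    by (intro nn_integral_cong) (auto simp: exp_minus field_simps split: split_indicator)
  also have "\<dots> = ennreal c * (\<integral>\<^sup>+t. ?f (0 + c * t) \<partial>lborel)"
    using assms by (subst nn_integral_real_affine[where c = c and t = 0]) auto
  also have "\<dots> = ennreal c * (ennreal (c powr (a - 1))
      * (\<integral>\<^sup>+t. ennreal (indicator {0<..} t * (t powr (a - 1) * exp (- (c * t)))) \<partial>lborel))"
    by (subst nn_integral_cmult[symmetric]) (auto simp: eq)
  also have "\<dots> = ennreal (c powr a)
      * (\<integral>\<^sup>+t. ennreal (indicator {0<..} t * (t powr (a - 1) * exp (- (c * t)))) \<partial>lborel)"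
    using assms by (simp add: mult.assoc[symmetric] ennreal_mult[symmetric] powr_diff)
  \<comment> \<open>Multiplying by \<open>c powr (- a)\<close> cancels the finite nonzero factor
    \<open>c powr a\<close> within \<open>ennreal\<close>.\<close>
  finally have "ennreal (c powr (- a)) * ennreal (Gamma a) =
      ennreal (c powr (- a)) * ennreal (c powr a)
      * (\<integral>\<^sup>+t. ennreal (indicator {0<..} t * (t powr (a - 1) * exp (- (c * t)))) \<partial>lborel)"
    by (simp add: mult.assoc)
  moreover have "ennreal (c powr (- a)) * ennreal (c powr a) = 1"
    using assms by (simp add: ennreal_mult[symmetric] powr_add[symmetric])
  ultimately show ?thesis
    using assms by (simp add: ennreal_mult' mult.commute)
qed

lemma has_bochner_integral_Gamma:
  fixes a :: real
  assumes "a > 0"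
  shows "has_bochner_integral lborel (\<lambda>t. indicator {0<..} t * (t powr (a - 1) * exp (- t))) (Gamma a)"
  using nn_integral_Gamma_scaled[OF assms, of 1] assms
  by (intro has_bochner_integral_nn_integral) (auto intro!: less_imp_le[OF Gamma_real_pos])

text \<open>Tonelli applied to \<open>\<Gamma>(p + q) (1 + x)\<^sup>-\<^sup>p\<^sup>-\<^sup>q = \<integral>\<^sub>0\<^sup>\<infinity> t\<^sup>p\<^sup>+\<^sup>q\<^sup>-\<^sup>1 e\<^sup>-\<^sup>(\<^sup>1\<^sup>+\<^sup>x\<^sup>)\<^sup>t dt\<close>.\<close>

lemma has_bochner_integral_Beta_prime:
  fixes p q :: real
  assumes p: "p > 0" and q: "q > 0"
  shows "has_bochner_integral lborel
    (\<lambda>x. indicator {0<..} x * (x powr (p - 1) * (1 + x) powr (- (p + q)))) (Beta p q)"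
proof -
  define I where "I = (\<integral>\<^sup>+x. ennreal (indicator {0<..} x * (x powr (p - 1) * (1 + x) powr (- (p + q)))) \<partial>lborel)"
  define F :: "real \<Rightarrow> real \<Rightarrow> real" where "F = (\<lambda>x t. indicator {0<..} x * indicator {0<..} t *
    (x powr (p - 1) * t powr (p + q - 1) * exp (- ((1 + x) * t))))"
  have [measurable]: "(\<lambda>(x, t). ennreal (F x t)) \<in> borel_measurable (lborel \<Otimes>\<^sub>M lborel)"
    unfolding F_def case_prod_unfold by measurable
  have 1: "(\<integral>\<^sup>+t. ennreal (F x t) \<partial>lborel) = ennreal (Gamma (p + q)) *
      ennreal (indicator {0<..} x * (x powr (p - 1) * (1 + x) powr (- (p + q))))" for x
  proof (cases "x > 0")
    case True
    have "(\<integral>\<^sup>+t. ennreal (F x t) \<partial>lborel) = (\<integral>\<^sup>+t. ennreal (x powr (p - 1)) *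
        ennreal (indicator {0<..} t * (t powr (p + q - 1) * exp (- ((1 + x) * t)))) \<partial>lborel)"
      using True by (intro nn_integral_cong) (auto simp: F_def simp flip: ennreal_mult' split: split_indicator)
    also have "\<dots> = ennreal (x powr (p - 1)) * ennreal (Gamma (p + q) * (1 + x) powr (- (p + q)))"
      using True p q by (subst nn_integral_cmult) (auto simp: nn_integral_Gamma_scaled)
    also have "\<dots> = ennreal (Gamma (p + q)) *
      ennreal (indicator {0<..} x * (x powr (p - 1) * (1 + x) powr (- (p + q))))"
      using True p q by (simp add: ennreal_mult[symmetric] Gamma_real_pos less_imp_le mult_ac)
    finally show ?thesis .
  qed (simp add: F_def)
  \<comment> \<open>Splitting \<open>exp (- ((1 + x) * t))\<close> into
    \<open>exp (- t) * exp (- (t * x))\<close> leaves a Gamma integral of shape \<open>p\<close> and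
    rate \<open>t\<close>; its factor \<open>t powr (- p)\<close> reduces the power of
    \<open>t\<close> to \<open>q - 1\<close>.\<close>
  have 2: "(\<integral>\<^sup>+x. ennreal (F x t) \<partial>lborel) = ennreal (Gamma p) *
      ennreal (indicator {0<..} t * (t powr (q - 1) * exp (- t)))" for t
  proof (cases "t > 0")
    case True
    have "(\<integral>\<^sup>+x. ennreal (F x t) \<partial>lborel) = (\<integral>\<^sup>+x. ennreal (t powr (p + q - 1) * exp (- t)) *
        ennreal (indicator {0<..} x * (x powr (p - 1) * exp (- (t * x)))) \<partial>lborel)"
      using True by (intro nn_integral_cong)
        (auto simp: F_def algebra_simps exp_add[symmetric] exp_diff exp_minus field_simps simp flip: ennreal_mult' split: split_indicator)
    also have "\<dots> = ennreal (t powr (p + q - 1) * exp (- t)) * ennreal (Gamma p * t powr (- p))"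
      using True p by (subst nn_integral_cmult) (auto simp: nn_integral_Gamma_scaled)
    also have "\<dots> = ennreal (Gamma p) * ennreal (t powr (p + q - 1) * t powr (- p) * exp (- t))"
      using True p q by (simp add: ennreal_mult[symmetric] Gamma_real_pos less_imp_le mult_ac)
    finally show ?thesis
      using True by (simp add: powr_add[symmetric])
  qed (simp add: F_def)
  have "ennreal (Gamma (p + q)) * I = (\<integral>\<^sup>+x. \<integral>\<^sup>+t. ennreal (F x t) \<partial>lborel \<partial>lborel)"
    unfolding 1 I_def by (subst nn_integral_cmult) auto
  also have "\<dots> = (\<integral>\<^sup>+t. \<integral>\<^sup>+x. ennreal (F x t) \<partial>lborel \<partial>lborel)"
    by (rule lborel_pair.Fubini') simp
  also have "\<dots> = ennreal (Gamma p) * ennreal (Gamma q)"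
    unfolding 2 using nn_integral_Gamma_scaled[OF q, of 1] by (subst nn_integral_cmult) auto
  finally have *: "ennreal (Gamma (p + q)) * I = ennreal (Gamma p * Gamma q)"
    using p q by (simp add: ennreal_mult[symmetric] Gamma_real_pos less_imp_le)
  have G: "Gamma (p + q) > 0" "Gamma p > 0" "Gamma q > 0"
    using p q by auto
  \<comment> \<open>\<open>I\<close> could a priori be infinite; multiplying by the reciprocal of a
    positive real yields finiteness and value at once.\<close>
  have "I = ennreal (1 / Gamma (p + q)) * (ennreal (Gamma (p + q)) * I)"
    using G by (simp add: mult.assoc[symmetric] ennreal_mult[symmetric])
  also have "\<dots> = ennreal (Beta p q)"
    unfolding * using G by (simp add: ennreal_mult[symmetric] Beta_def)
  finally have "I = ennreal (Beta p q)" .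
  moreover have "Beta p q \<ge> 0"
    using G by (simp add: Beta_def)
  ultimately show ?thesis
    unfolding I_def by (intro has_bochner_integral_nn_integral) auto
qed

section \<open>The transform as a Lebesgue integral\<close>

lemma mellin_transform_gamma:
  assumes M: "M \<ge> 1" and \<zeta>: "\<zeta> > 0"
    and D: "distributed P lborel X (\<lambda>x. ennreal (gamma_density M \<zeta> x))"
  shows "mellin_transform P (\<lambda>\<omega>. service (X \<omega>)) s =
    (\<integral>x. indicator {0<..} x * (x powr (real M - 1) * (1 + x) powr (s - 1) * exp (- x / \<zeta>)) \<partial>lborel)
      / (Gamma (real M) * \<zeta> powr real M)"
proof -
  have G: "Gamma (real M) > 0"
    using M by auto
  have "mellin_transform P (\<lambda>\<omega>. service (X \<omega>)) s
      = (\<integral>x. gamma_density M \<zeta> x * (1 + x) powr (s - 1) \<partial>lborel)"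
    unfolding mellin_transform_def service_def
    using M \<zeta> G
    by (subst distributed_integral[OF D, where g = "\<lambda>x. (1 + x) powr (s - 1)"]) (auto simp: gamma_density_def)
  also have "\<dots> = (\<integral>x. indicator {0<..} x * (x powr (real M - 1) * (1 + x) powr (s - 1) * exp (- x / \<zeta>))
      / (Gamma (real M) * \<zeta> powr real M) \<partial>lborel)"
  proof (rule integral_cong_AE)
    have [measurable]: "gamma_density M \<zeta> \<in> borel_measurable borel"
      unfolding gamma_density_def by measurable
    show "(\<lambda>x. gamma_density M \<zeta> x * (1 + x) powr (s - 1)) \<in> borel_measurable lborel"
      by measurable
    have *: "x ^ (M - Suc 0) = x powr (real M - 1)" if "x > 0" for x
      using that M by (simp add: powr_realpow[symmetric] of_nat_diff)
    \<comment> \<open>The point 0 is excluded because for \<open>M = 1\<close> the density there is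
      \<open>1 / \<zeta>\<close>, while the indicator vanishes.\<close>
    have "gamma_density M \<zeta> x * (1 + x) powr (s - 1) =
        indicator {0<..} x * (x powr (real M - 1) * (1 + x) powr (s - 1) * exp (- x / \<zeta>))
          / (Gamma (real M) * \<zeta> powr real M)" if "x \<noteq> 0" for x
      using that \<zeta> by (auto simp: gamma_density_def * powr_realpow split: split_indicator)
    then show "AE x in lborel. gamma_density M \<zeta> x * (1 + x) powr (s - 1) =
        indicator {0<..} x * (x powr (real M - 1) * (1 + x) powr (s - 1) * exp (- x / \<zeta>))
          / (Gamma (real M) * \<zeta> powr real M)"
      using AE_lborel_singleton[of 0] by (auto elim!: eventually_mono)
  qed measurable
  finally show ?thesis
    by simp
qed

section \<open>Convergent case: \<open>p + r < 0\<close>\<close>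

text \<open>The undamped integrand is the Beta kernel with \<open>q = - (p + r) > 0\<close>. It is
  both the pointwise limit and the dominating function, as the exponential factor is at most
  1.\<close>

lemma tendsto_exp_damped_Beta_integral:
  fixes p r :: real
  assumes p: "p > 0" and r: "p + r < 0"
  shows "((\<lambda>\<zeta>. \<integral>x. indicator {0<..} x * (x powr (p - 1) * (1 + x) powr r * exp (- x / \<zeta>)) \<partial>lborel)
    \<longlongrightarrow> Beta p (- (p + r))) at_top"
proof -
  let ?f = "\<lambda>x::real. indicator {0<..} x * (x powr (p - 1) * (1 + x) powr r)"
  have B: "has_bochner_integral lborel ?f (Beta p (- (p + r)))"
    using has_bochner_integral_Beta_prime[of p "- (p + r)"] assms by simp
  have "((\<lambda>\<zeta>. \<integral>x. indicator {0<..} x * (x powr (p - 1) * (1 + x) powr r * exp (- x / \<zeta>)) \<partial>lborel)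
    \<longlongrightarrow> (\<integral>x. ?f x \<partial>lborel)) at_top"
  proof (rule integral_dominated_convergence_at_top[where w = ?f])
    show "integrable lborel ?f"
      using B by (auto simp: has_bochner_integral_iff)
    have "((\<lambda>\<zeta>. exp (- x / \<zeta>)) \<longlongrightarrow> 1) at_top" for x :: real
      by real_asymp
    from tendsto_mult[OF tendsto_const[of "?f x" for x] this]
    show "AE x in lborel. ((\<lambda>\<zeta>. indicator {0<..} x * (x powr (p - 1) * (1 + x) powr r * exp (- x / \<zeta>))) \<longlongrightarrow> ?f x) at_top"
      by (simp add: mult.assoc)
    show "\<forall>\<^sub>F \<zeta> in at_top. AE x in lborel.
        norm (indicator {0<..} x * (x powr (p - 1) * (1 + x) powr r * exp (- x / \<zeta>))) \<le> ?f x"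
      using eventually_gt_at_top[of 0]
      by eventually_elim (auto intro!: AE_I2 mult_left_le split: split_indicator)
  qed auto
  with B show ?thesis
    by (simp add: has_bochner_integral_iff)
qed

section \<open>Power growth: \<open>p + r > 0\<close>\<close>

lemma add_powr_le:
  fixes e u r :: real
  assumes "0 \<le> e" "e \<le> 1" "0 < u"
  shows "(e + u) powr r \<le> 2 powr \<bar>r\<bar> * (1 + u powr r)"
proof (cases "r \<ge> 0")
  case True
  have "(e + u) powr r \<le> (2 * max 1 u) powr r"
    using assms True by (intro powr_mono2) auto
  also have "\<dots> = 2 powr r * max 1 u powr r"
    by (simp add: powr_mult)
  also have "max 1 u powr r \<le> 1 + u powr r"
    by (auto simp: max_def)
  finally show ?thesis
    using True by simp
next
  case False
  have "(e + u) powr r \<le> u powr r"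
    using assms False by (intro powr_mono2') auto
  also have "\<dots> \<le> 1 * (1 + u powr r)"
    by simp
  also have "\<dots> \<le> 2 powr \<bar>r\<bar> * (1 + u powr r)"
    by (intro mult_right_mono) (auto simp: ge_one_powr_ge_zero)
  finally show ?thesis .
qed

lemma tendsto_exp_damped_Gamma_integral:
  fixes p r :: real
  assumes p: "p > 0" and r: "p + r > 0"
  shows "((\<lambda>\<zeta>. (\<integral>x. indicator {0<..} x * (x powr (p - 1) * (1 + x) powr r * exp (- x / \<zeta>)) \<partial>lborel)
      / \<zeta> powr (p + r)) \<longlongrightarrow> Gamma (p + r)) at_top"
proof -
  let ?k = "\<lambda>a t::real. indicator {0<..} t * (t powr (a - 1) * exp (- t)) :: real"
  let ?g = "\<lambda>\<zeta> u::real. indicator {0<..} u * (u powr (p - 1) * (1 / \<zeta> + u) powr r * exp (- u)) :: real"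
  have pr: "u powr (p - 1) * u powr r = u powr (p + r - 1)" for u :: real
    by (simp add: powr_add[symmetric] algebra_simps)
  have "((\<lambda>\<zeta>. \<integral>u. ?g \<zeta> u \<partial>lborel) \<longlongrightarrow> (\<integral>u. ?k (p + r) u \<partial>lborel)) at_top"
  \<comment> \<open>The summands \<open>1\<close> and \<open>u powr r\<close> of
    \<open>add_powr_le\<close> give Gamma kernels of shapes \<open>p\<close> and
    \<open>p + r\<close>, both integrable.\<close>
  proof (rule integral_dominated_convergence_at_top[where w = "\<lambda>u. 2 powr \<bar>r\<bar> * (?k p u + ?k (p + r) u)"])
    show "integrable lborel (\<lambda>u. 2 powr \<bar>r\<bar> * (?k p u + ?k (p + r) u))"
      using has_bochner_integral_Gamma[OF p] has_bochner_integral_Gamma[OF r]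
      by (intro integrable_mult_right Bochner_Integration.integrable_add) (auto simp: has_bochner_integral_iff)
    have lim: "((\<lambda>\<zeta>. ?g \<zeta> u) \<longlongrightarrow> ?k (p + r) u) at_top" for u
    proof (cases "u > 0")
      case True
      have "((\<lambda>\<zeta>::real. 1 / \<zeta>) \<longlongrightarrow> 0) at_top"
        by real_asymp
      then have "((\<lambda>\<zeta>. ?g \<zeta> u) \<longlongrightarrow> indicator {0<..} u * (u powr (p - 1) * (0 + u) powr r * exp (- u))) at_top"
        using True by (intro tendsto_intros) auto
      then show ?thesis
        by (simp add: pr)
    qed simp
    then show "AE u in lborel. ((\<lambda>\<zeta>. ?g \<zeta> u) \<longlongrightarrow> ?k (p + r) u) at_top"
      by simp
    show "\<forall>\<^sub>F \<zeta> in at_top. AE u in lborel. norm (?g \<zeta> u) \<le> 2 powr \<bar>r\<bar> * (?k p u + ?k (p + r) u)"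
      using eventually_ge_at_top[of 1]
    proof eventually_elim
      case (elim \<zeta>)
      have "norm (?g \<zeta> u) \<le> 2 powr \<bar>r\<bar> * (?k p u + ?k (p + r) u)" for u
      proof (cases "u > 0")
        case True
        have "(1 / \<zeta> + u) powr r * (u powr (p - 1) * exp (- u))
            \<le> 2 powr \<bar>r\<bar> * (1 + u powr r) * (u powr (p - 1) * exp (- u))"
          using elim True by (intro mult_right_mono add_powr_le) auto
        with True show ?thesis
          by (simp add: algebra_simps flip: pr)
      qed simp
      then show ?case
        by simp
    qed
  qed auto
  then have "((\<lambda>\<zeta>. \<integral>u. ?g \<zeta> u \<partial>lborel) \<longlongrightarrow> Gamma (p + r)) at_top"
    using has_bochner_integral_Gamma[OF r] by (simp add: has_bochner_integral_iff)
  moreover have "\<forall>\<^sub>F \<zeta> in at_top. (\<integral>u. ?g \<zeta> u \<partial>lborel) =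
    (\<integral>x. indicator {0<..} x * (x powr (p - 1) * (1 + x) powr r * exp (- x / \<zeta>)) \<partial>lborel) / \<zeta> powr (p + r)"
    using eventually_gt_at_top[of 0]
  proof eventually_elim
    case (elim \<zeta>)
    \<comment> \<open>Under \<open>x = \<zeta> * u\<close> the integrand contributes
      \<open>\<zeta> powr (p + r - 1)\<close>, and the Jacobian one more factor
      \<open>\<zeta>\<close>.\<close>
    have *: "(\<zeta> * u) powr (p - 1) * (1 + \<zeta> * u) powr r = \<zeta> powr (p + r - 1) * (u powr (p - 1) * (1 / \<zeta> + u) powr r)"
      if "u > 0" for u
    proof -
      have "1 + \<zeta> * u = \<zeta> * (1 / \<zeta> + u)"
        using elim by (simp add: field_simps)
      then show ?thesis
        using elim that by (simp add: powr_mult pr[symmetric])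
    qed
    have **: "indicator {0<..} (0 + \<zeta> * u) * ((0 + \<zeta> * u) powr (p - 1) * (1 + (0 + \<zeta> * u)) powr r * exp (- (0 + \<zeta> * u) / \<zeta>))
      = \<zeta> powr (p + r - 1) * ?g \<zeta> u" for u
      using elim by (auto simp: * zero_less_mult_iff split: split_indicator)
    have "(\<integral>x. indicator {0<..} x * (x powr (p - 1) * (1 + x) powr r * exp (- x / \<zeta>)) \<partial>lborel)
      = \<zeta> * (\<zeta> powr (p + r - 1) * (\<integral>u. ?g \<zeta> u \<partial>lborel))"
      using elim
      by (subst lborel_integral_real_affine[where c = \<zeta> and t = 0], simp, subst **) simp
    then show ?case
      using elim by (simp add: powr_diff field_simps)
  qed
  ultimately show ?thesis
    using tendsto_cong by force
qed

section \<open>Logarithmic growth: the borderline exponent\<close>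

text \<open>Since \<open>f = (1 - 1 / (1 + x)) ^ (M - 1) / (1 + x)\<close>, the power is at most 1,
  and Bernoulli's inequality bounds it below. The gap between the bounds has integral
  \<open>M - 1\<close> over the half-line, hence costs only O(1).\<close>

lemma borderline_integrand_bounds:
  fixes x :: real
  assumes M: "M \<ge> 1" and x: "x > 0"
  defines "f \<equiv> x powr (real M - 1) * (1 + x) powr (- real M)"
  shows "f \<le> 1 / (1 + x)" and "1 / (1 + x) - (real M - 1) / (1 + x)\<^sup>2 \<le> f"
proof -
  have f: "f = (1 - 1 / (1 + x)) ^ (M - 1) / (1 + x)"
  proof -
    have "f = x ^ (M - 1) * (1 / ((1 + x) ^ (M - 1) * (1 + x)))"
      using M x by (simp add: f_def powr_minus powr_realpow[symmetric] of_nat_diff powr_diff divide_inverse)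
    also have "\<dots> = (x / (1 + x)) ^ (M - 1) / (1 + x)"
      by (simp add: power_divide)
    also have "x / (1 + x) = 1 - 1 / (1 + x)"
      using x by (simp add: field_simps)
    finally show ?thesis .
  qed
  have "(1 - 1 / (1 + x)) ^ (M - 1) \<le> 1"
    using x by (intro power_le_one) auto
  then show "f \<le> 1 / (1 + x)"
    unfolding f using x by (intro divide_right_mono) auto
  have "1 + real (M - 1) * (- (1 / (1 + x))) \<le> (1 + - (1 / (1 + x))) ^ (M - 1)"
    using x by (intro Bernoulli_inequality) auto
  then have "(1 - (real M - 1) / (1 + x)) / (1 + x) \<le> f"
    unfolding f using x M by (intro divide_right_mono) (auto simp: of_nat_diff)
  then show "1 / (1 + x) - (real M - 1) / (1 + x)\<^sup>2 \<le> f"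
    by (simp add: diff_divide_distrib power2_eq_square)
qed

text \<open>Split at \<open>x = \<zeta>\<close>. The main part \<open>1 / (1 + x)\<close> integrates
  to \<open>ln (1 + \<zeta>)\<close>. Above, the tail costs at most the mass 1 of an exponential
  density. Below, the tail is dropped; the Bernoulli correction costs at most \<open>M - 1\<close>
  and the damping at most 1.\<close>

lemma exp_damped_borderline_integral_bounds:
  assumes M: "M \<ge> 1" and \<zeta>: "\<zeta> > 0"
  defines "K \<equiv> \<integral>x. indicator {0<..} x * (x powr (real M - 1) * (1 + x) powr (- real M) * exp (- x / \<zeta>)) \<partial>lborel"
  shows "K \<le> ln (1 + \<zeta>) + 1" and "ln (1 + \<zeta>) - real M \<le> K"
proof -
  let ?F = "\<lambda>x. indicator {0<..} x * (x powr (real M - 1) * (1 + x) powr (- real M) * exp (- x / \<zeta>)) :: real"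
  let ?U = "\<lambda>x. indicator {0..\<zeta>} x *\<^sub>R (1 / (1 + x)) + exponential_density (1 / \<zeta>) x"
  let ?L = "\<lambda>x. indicator {0..\<zeta>} x *\<^sub>R (1 / (1 + x) - (real M - 1) / (1 + x)\<^sup>2 - 1 / \<zeta>)"
  have cont: "continuous_on {0..\<zeta>} (\<lambda>x. 1 / (1 + x))"
    "continuous_on {0..\<zeta>} (\<lambda>x. 1 / (1 + x) - (real M - 1) / (1 + x)\<^sup>2 - 1 / \<zeta>)"
    by (auto intro!: continuous_intros)
  interpret E: prob_space "density lborel (exponential_density (1 / \<zeta>))"
    using \<zeta> by (intro prob_space_exponential_density) auto
  have E: "has_bochner_integral lborel (exponential_density (1 / \<zeta>)) 1"
    using E.emeasure_space_1 \<zeta>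
    by (intro has_bochner_integral_nn_integral) (auto simp: emeasure_density exponential_density_nonneg)
  have U: "has_bochner_integral lborel ?U (ln (1 + \<zeta>) - ln (1 + 0) + 1)"
    using \<zeta> cont(1)
    by (intro has_bochner_integral_add E has_bochner_integral_FTC_Icc)
       (auto intro!: derivative_eq_intros simp: has_real_derivative_iff_has_vector_derivative[symmetric])
  \<comment> \<open>The antiderivative is
    \<open>ln (1 + x) + (M - 1) / (1 + x) - x / \<zeta>\<close>, kept unsimplified at both endpoints
    to match the fundamental theorem.\<close>
  have L: "has_bochner_integral lborel ?L
      ((ln (1 + \<zeta>) + (real M - 1) / (1 + \<zeta>) - \<zeta> / \<zeta>) - (ln (1 + 0) + (real M - 1) / (1 + 0) - 0 / \<zeta>))"
    using \<zeta> cont(2)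
    by (intro has_bochner_integral_FTC_Icc)
       (auto intro!: derivative_eq_intros
          simp: has_real_derivative_iff_has_vector_derivative[symmetric] power2_eq_square diff_divide_distrib)
  have FU: "?F x \<le> ?U x" for x
  proof (cases "x > 0")
    case True
    have 1: "?F x \<le> 1 / (1 + x) * exp (- x / \<zeta>)"
      using mult_right_mono[OF borderline_integrand_bounds(1)[OF M True], of "exp (- x / \<zeta>)"] True by simp
    show ?thesis
    proof (cases "x \<le> \<zeta>")
      case le: True
      have "1 / (1 + x) * exp (- x / \<zeta>) \<le> 1 / (1 + x)"
        using True \<zeta> by (intro mult_left_le) auto
      with 1 have "?F x \<le> 1 / (1 + x)"
        by (rule order_trans)
      with le True \<zeta> show ?thesis
        by (simp add: add_increasing2 exponential_density_nonneg)
    next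
      case False
      \<comment> \<open>Beyond \<open>\<zeta>\<close>, replacing \<open>1 / (1 + x)\<close> by
        \<open>1 / \<zeta>\<close> produces exactly the exponential density of rate
        \<open>1 / \<zeta>\<close>.\<close>
      have "1 / (1 + x) * exp (- x / \<zeta>) \<le> 1 / \<zeta> * exp (- x / \<zeta>)"
        using False \<zeta> by (intro mult_right_mono divide_left_mono) auto
      with 1 False True show ?thesis
        using \<zeta> by (simp add: exponential_density_def)
    qed
  next
    case False
    then show ?thesis
      using \<zeta> exponential_density_nonneg[of "1 / \<zeta>" x] by (auto split: split_indicator)
  qed
  have F: "integrable lborel ?F"
  proof (rule Bochner_Integration.integrable_bound)
    show "integrable lborel ?U"
      using U by (auto simp: has_bochner_integral_iff)
    have "norm (?F x) \<le> norm (?U x)" for x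
      using FU[of x] by simp
    then show "AE x in lborel. norm (?F x) \<le> norm (?U x)"
      by simp
  qed measurable
  have "K \<le> (\<integral>x. ?U x \<partial>lborel)"
    unfolding K_def using U by (intro integral_mono F FU) (auto simp: has_bochner_integral_iff)
  then show "K \<le> ln (1 + \<zeta>) + 1"
    using U by (simp add: has_bochner_integral_iff)
  \<comment> \<open>At 0 this can fail: for \<open>M = 1\<close> and \<open>\<zeta> > 1\<close>,
    \<open>?L 0 > 0 = ?F 0\<close>.\<close>
  have LF: "?L x \<le> ?F x" if "x \<noteq> 0" for x
  proof (cases "x \<in> {0<..\<zeta>}")
    case True
    let ?f = "x powr (real M - 1) * (1 + x) powr (- real M)"
    note b = borderline_integrand_bounds[of M x]
    have "?f * (x / \<zeta>) \<le> 1 / (1 + x) * (x / \<zeta>)"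
      using b(1) M True by (intro mult_right_mono) auto
    also have "\<dots> = x / (1 + x) / \<zeta>"
      by simp
    also have "\<dots> \<le> 1 / \<zeta>"
      using True \<zeta> by (intro divide_right_mono) auto
    \<comment> \<open>The damping is bounded below by \<open>1 - x / \<zeta>\<close>, so the loss is
      at most \<open>1 / \<zeta>\<close> at each point of an interval of length
      \<open>\<zeta>\<close>.\<close>
    finally have "?f - 1 / \<zeta> \<le> ?f * (1 + - x / \<zeta>)"
      by (simp add: algebra_simps)
    also have "\<dots> \<le> ?f * exp (- x / \<zeta>)"
      using True by (intro mult_left_mono exp_ge_add_one_self) auto
    finally show ?thesis
      using b(2) M True by auto
  qed (use that in \<open>auto split: split_indicator\<close>)
  have "(\<integral>x. ?L x \<partial>lborel) \<le> K"
    unfolding K_def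
  proof (rule integral_mono_AE)
    show "integrable lborel ?L"
      using L by (auto simp: has_bochner_integral_iff)
    show "AE x in lborel. ?L x \<le> ?F x"
      using AE_lborel_singleton[of 0] by eventually_elim (rule LF)
  qed (rule F)
  moreover have "(\<integral>x. ?L x \<partial>lborel) = ln (1 + \<zeta>) + (real M - 1) / (1 + \<zeta>) - real M"
    using L \<zeta> by (simp add: has_bochner_integral_iff)
  moreover have "(real M - 1) / (1 + \<zeta>) \<ge> 0"
    using M \<zeta> by simp
  ultimately show "ln (1 + \<zeta>) - real M \<le> K"
    by linarith
qed

text \<open>Both bounds on the integral and the denominator are \<open>ln \<zeta> + O(1)\<close>, so
  the quotient is squeezed to 1. The instance used later is
  \<open>c = Digamma (real M)\<close>.\<close>

lemma tendsto_exp_damped_borderline_integral: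
  assumes M: "M \<ge> 1"
  shows "((\<lambda>\<zeta>. (\<integral>x. indicator {0<..} x * (x powr (real M - 1) * (1 + x) powr (- real M) * exp (- x / \<zeta>)) \<partial>lborel)
    / (ln \<zeta> - c)) \<longlongrightarrow> 1) at_top"
proof (rule tendsto_sandwich)
  show "((\<lambda>\<zeta>. (ln (1 + \<zeta>) - real M) / (ln \<zeta> - c)) \<longlongrightarrow> 1) at_top"
    by real_asymp
  show "((\<lambda>\<zeta>. (ln (1 + \<zeta>) + 1) / (ln \<zeta> - c)) \<longlongrightarrow> 1) at_top"
    by real_asymp
  \<comment> \<open>Division by the denominator preserves the bounds only once it is
    positive.\<close>
  have pos: "\<forall>\<^sub>F \<zeta> in at_top. ln \<zeta> - c > 0"
    by real_asymp
  show "\<forall>\<^sub>F \<zeta> in at_top. (ln (1 + \<zeta>) - real M) / (ln \<zeta> - c) \<le>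
      (\<integral>x. indicator {0<..} x * (x powr (real M - 1) * (1 + x) powr (- real M) * exp (- x / \<zeta>)) \<partial>lborel)
    / (ln \<zeta> - c)"
    using pos eventually_gt_at_top[of 0]
    by eventually_elim (intro divide_right_mono exp_damped_borderline_integral_bounds M, auto)
  show "\<forall>\<^sub>F \<zeta> in at_top.
      (\<integral>x. indicator {0<..} x * (x powr (real M - 1) * (1 + x) powr (- real M) * exp (- x / \<zeta>)) \<partial>lborel)
    / (ln \<zeta> - c) \<le> (ln (1 + \<zeta>) + 1) / (ln \<zeta> - c)"
    using pos eventually_gt_at_top[of 0]
    by eventually_elim (intro divide_right_mono exp_damped_borderline_integral_bounds M, auto)
qed

section \<open>The limit of the quotient in the three regimes\<close>

theorem corollary3:
  fixes M :: nat and s :: real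
    and P :: "real \<Rightarrow> 'a measure" and \<gamma> :: "real \<Rightarrow> 'a \<Rightarrow> real"
  assumes "M \<ge> 1"
    and "\<And>\<zeta>. \<zeta> > 0 \<Longrightarrow> prob_space (P \<zeta>)"
    and "\<And>\<zeta>. \<zeta> > 0 \<Longrightarrow> distributed (P \<zeta>) lborel (\<gamma> \<zeta>) (\<lambda>x. ennreal (gamma_density M \<zeta> x))"
  shows "((\<lambda>\<zeta>. mellin_transform (P \<zeta>) (\<lambda>\<omega>. service (\<gamma> \<zeta> \<omega>)) s / mellin_high_snr M \<zeta> s)
           \<longlongrightarrow> 1) at_top"
proof -
  define K where "K = (\<lambda>\<zeta>. \<integral>x. indicator {0<..} x *
    (x powr (real M - 1) * (1 + x) powr (s - 1) * exp (- x / \<zeta>)) \<partial>lborel)"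
  have G: "Gamma (real M) > 0"
    using assms(1) by auto
  have "((\<lambda>\<zeta>. K \<zeta> / (Gamma (real M) * \<zeta> powr real M) / mellin_high_snr M \<zeta> s) \<longlongrightarrow> 1) at_top"
  proof (cases s "1 - real M" rule: linorder_cases)
    case less
    have pos: "Gamma (1 - s - real M) > 0" "Gamma (1 - s) > 0"
      using less assms(1) by auto
    have "(K \<longlongrightarrow> Beta (real M) (1 - s - real M)) at_top"
      using tendsto_exp_damped_Beta_integral[of "real M" "s - 1"] less assms(1)
      by (simp add: K_def algebra_simps)
    then have "((\<lambda>\<zeta>. K \<zeta> / Beta (real M) (1 - s - real M)) \<longlongrightarrow> 1) at_top"
      using pos G by (auto simp: Beta_def intro!: tendsto_eq_intros)
    then show ?thesis
    proof (rule Lim_transform_eventually)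
      \<comment> \<open>Expanding \<open>Beta\<close> as a quotient of Gamma values, the factors
        \<open>Gamma (real M)\<close> and \<open>\<zeta> powr real M\<close> cancel.\<close>
      show "\<forall>\<^sub>F \<zeta> in at_top. K \<zeta> / Beta (real M) (1 - s - real M) =
          K \<zeta> / (Gamma (real M) * \<zeta> powr real M) / mellin_high_snr M \<zeta> s"
        using eventually_gt_at_top[of 0]
        by eventually_elim (use less in \<open>simp add: mellin_high_snr_def Beta_def powr_minus field_simps\<close>)
    qed
  next
    case equal
    \<comment> \<open>Here \<open>s - 1 = - real M\<close>, so \<open>K\<close> is the borderline
      integral.\<close>
    from tendsto_exp_damped_borderline_integral[OF assms(1), of "Digamma (real M)"]
    have "((\<lambda>\<zeta>. K \<zeta> / (ln \<zeta> - Digamma (real M))) \<longlongrightarrow> 1) at_top"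
      using equal by (simp add: K_def)
    then show ?thesis
    proof (rule Lim_transform_eventually)
      show "\<forall>\<^sub>F \<zeta> in at_top. K \<zeta> / (ln \<zeta> - Digamma (real M)) =
          K \<zeta> / (Gamma (real M) * \<zeta> powr real M) / mellin_high_snr M \<zeta> s"
        using eventually_gt_at_top[of 0]
        by eventually_elim (use equal G in \<open>simp add: mellin_high_snr_def powr_minus\<close>)
    qed
  next
    case greater
    have pos: "Gamma (s + real M - 1) > 0"
      using greater by auto
    have "((\<lambda>\<zeta>. K \<zeta> / \<zeta> powr (s + real M - 1)) \<longlongrightarrow> Gamma (s + real M - 1)) at_top"
      using tendsto_exp_damped_Gamma_integral[of "real M" "s - 1"] greater assms(1)
      by (simp add: K_def algebra_simps)
    then have "((\<lambda>\<zeta>. K \<zeta> / \<zeta> powr (s + real M - 1) / Gamma (s + real M - 1)) \<longlongrightarrow> 1) at_top"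
      using tendsto_divide[OF _ tendsto_const, of _ _ _ "Gamma (s + real M - 1)"] pos by fastforce
    then show ?thesis
    proof (rule Lim_transform_eventually)
      show "\<forall>\<^sub>F \<zeta> in at_top. K \<zeta> / \<zeta> powr (s + real M - 1) / Gamma (s + real M - 1) =
          K \<zeta> / (Gamma (real M) * \<zeta> powr real M) / mellin_high_snr M \<zeta> s"
        using eventually_gt_at_top[of 0]
      proof eventually_elim
        case (elim \<zeta>)
        have "\<zeta> powr (s + real M - 1) = \<zeta> powr real M * \<zeta> powr (s - 1)"
          by (simp add: powr_add[symmetric] algebra_simps)
        then show ?case
          using greater G elim by (simp add: mellin_high_snr_def)
      qed
    qed
  qed
  then show ?thesis
  proof (rule Lim_transform_eventually)
    \<comment> \<open>The law of \<open>\<gamma> \<zeta>\<close> is given only for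
      \<open>\<zeta> > 0\<close>, so \<open>K\<close> and the transform are identified
      eventually.\<close>
    show "\<forall>\<^sub>F \<zeta> in at_top. K \<zeta> / (Gamma (real M) * \<zeta> powr real M) / mellin_high_snr M \<zeta> s =
        mellin_transform (P \<zeta>) (\<lambda>\<omega>. service (\<gamma> \<zeta> \<omega>)) s / mellin_high_snr M \<zeta> s"
      using eventually_gt_at_top[of 0]
      by eventually_elim (simp add: mellin_transform_gamma[OF assms(1) _ assms(3)] K_def)
  qed
qed

end
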